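(* Let $X$ be a smooth projective curve over $\mathbb{C}$ and let $(V,q)$ be a quadratic bundle of rank $3$ on $X$ (a conic bundle) where $q$ is generically non-degenerate. If $(V,q)$ satisfies the $\delta$-(semi)-stability condition for $\delta=1$, then $(V,q)$ satisfies the Gómez–Sols semi-stability condition with respect to $\tau$ for all $\tau>0$.
   Context: For $\delta=1$, the $\delta$-(semi)-stability condition on $(V,q)$ means that the underlying vector bundle $V$ is (semi)-stable. Gómez–Sols semi-stability. Let $(E,Q)$ be a conic bundle: a rank $3$ vector bundle with a quadratic form $Q:\mathrm{Sym}^2E\to\mathcal{O}_X$. Two subbundles $E_1\subset E_2\subset E$ give a critical filtration if $\mathrm{rank}(E_1)=1$, $\mathrm{rank}(E_2)=2$, $Q|_{E_1E_2}=0$ and $Q|_{E_1E}\ne0\ne Q|_{E_2E}$. For a positive rational $\tau$, $(E,Q)$ is (semi)-stable with respect to $\tau$ if: (ss.1) for every proper subbundle $E'$ of $E$, $\dfrac{\deg(E')-c_Q(E')\tau}{\mathrm{rank}(E')}\le\dfrac{\deg(E)-2\tau}{3}$, where $c_Q(E')=2$ if $Q(E',E')\neq0$, else $1$ if $Q(E',E)\ne0$, and $0$ otherwise; (ss.2) for every critical filtration $E_1\subset E_2\subset E$, $\deg(E_1)+\deg(E_2)\le\deg(E)$. (With strict inequalities for stability.) *)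

theory Defs
  imports "HOL-Analysis.Analysis" "Jordan_Normal_Form.Determinant"
begin

section \<open>Smooth projective curves over the complex numbers\<close>

text \<open>
  A curve is an irreducible closed subvariety of a projective space; its points are the closed
  points. With \<^term>\<open>CARD('n)\<close> homogeneous coordinates, a point of projective space is a line in
  \<^typ>\<open>complex^'n\<close>. Since the ground field is infinite, polynomials are identified with the
  functions they induce.
\<close>

type_synonym 'n ppoint = "(complex^'n) set"

definition proj_space :: "('n::finite) ppoint set" where
  "proj_space = {L. vec.subspace L \<and> vec.dim L = 1}"

definition homogeneous_poly :: "nat \<Rightarrow> (complex^'n::finite \<Rightarrow> complex) \<Rightarrow> bool" where
  "homogeneous_poly d F \<longleftrightarrow>
     (\<exists>c :: ('n \<Rightarrow> nat) \<Rightarrow> complex.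
        F = (\<lambda>v. \<Sum>m | (\<Sum>i\<in>UNIV. m i) = d. c m * (\<Prod>i\<in>UNIV. vec_nth v i ^ m i)))"

definition zero_locus :: "(complex^'n::finite \<Rightarrow> complex) set \<Rightarrow> 'n ppoint set" where
  "zero_locus S = {L \<in> proj_space. \<forall>F\<in>S. \<forall>v\<in>L. F v = 0}"

definition zariski_closed :: "('n::finite) ppoint set \<Rightarrow> bool" where
  "zariski_closed Z \<longleftrightarrow> (\<exists>S. (\<forall>F\<in>S. \<exists>d. homogeneous_poly d F) \<and> Z = zero_locus S)"

definition zariski_open_in :: "('n::finite) ppoint set \<Rightarrow> 'n ppoint set \<Rightarrow> bool" where
  "zariski_open_in X U \<longleftrightarrow> (\<exists>Z. zariski_closed Z \<and> U = X - Z)"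

definition irreducible_closed :: "('n::finite) ppoint set \<Rightarrow> bool" where
  "irreducible_closed Z \<longleftrightarrow> zariski_closed Z \<and> Z \<noteq> {} \<and>
     (\<forall>A B. zariski_closed A \<and> zariski_closed B \<and> Z = A \<union> B \<longrightarrow> Z = A \<or> Z = B)"

definition irreducible_chain :: "('n::finite) ppoint set \<Rightarrow> nat \<Rightarrow> bool" where
  "irreducible_chain X d \<longleftrightarrow>
     (\<exists>Z. (\<forall>i\<le>d. irreducible_closed (Z i) \<and> Z i \<subseteq> X) \<and> (\<forall>i<d. Z i \<subset> Z (Suc i)))"

definition has_dimension :: "('n::finite) ppoint set \<Rightarrow> nat \<Rightarrow> bool" where
  "has_dimension X d \<longleftrightarrow> irreducible_chain X d \<and> \<not> irreducible_chain X (Suc d)"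

definition gradient :: "(complex^'n::finite \<Rightarrow> complex) \<Rightarrow> complex^'n \<Rightarrow> complex^'n" where
  "gradient F v = (\<chi> i. deriv (\<lambda>t. F (v + axis i t)) 0)"

definition homogeneous_ideal :: "('n::finite) ppoint set \<Rightarrow> (complex^'n \<Rightarrow> complex) set" where
  "homogeneous_ideal X = {F. (\<exists>d. homogeneous_poly d F) \<and> (\<forall>L\<in>X. \<forall>v\<in>L. F v = 0)}"

text \<open>
  Jacobian criterion: at each point the Jacobian has rank \<open>N - 1\<close>, where \<open>N = CARD('n) - 1\<close> is
  the dimension of the ambient projective space. Homogeneous coordinates may be used for the
  Jacobian because of Euler's relation.
\<close>

definition smooth_projective_curve :: "('n::finite) ppoint set \<Rightarrow> bool" where
  "smooth_projective_curve X \<longleftrightarrow>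
     irreducible_closed X \<and> has_dimension X 1 \<and>
     (\<forall>p\<in>X. \<forall>v\<in>p - {0}. vec.dim ((\<lambda>F. gradient F v) ` homogeneous_ideal X) + 2 = CARD('n))"

definition regular_on :: "('n::finite) ppoint set \<Rightarrow> 'n ppoint set \<Rightarrow> ('n ppoint \<Rightarrow> complex) \<Rightarrow> bool" where
  "regular_on X U f \<longleftrightarrow>
     (\<forall>p\<in>U. \<exists>W d G H. zariski_open_in X W \<and> p \<in> W \<and> W \<subseteq> U \<and>
        homogeneous_poly d G \<and> homogeneous_poly d H \<and>
        (\<forall>x\<in>W. \<forall>v\<in>x - {0}. H v \<noteq> 0 \<and> f x = G v / H v))"

text \<open>A generator of the maximal ideal of the local ring at \<open>p\<close>.\<close>

definition uniformizer_at :: "('n::finite) ppoint set \<Rightarrow> 'n ppoint \<Rightarrow> ('n ppoint \<Rightarrow> complex) \<Rightarrow> bool" where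
  "uniformizer_at X p t \<longleftrightarrow>
     (\<exists>N. zariski_open_in X N \<and> p \<in> N \<and> regular_on X N t) \<and> t p = 0 \<and>
     (\<forall>M g. zariski_open_in X M \<and> p \<in> M \<and> regular_on X M g \<and> g p = 0 \<longrightarrow>
        (\<exists>M' h. zariski_open_in X M' \<and> p \<in> M' \<and> M' \<subseteq> M \<and> regular_on X M' h \<and>
           (\<forall>x\<in>M'. g x = t x * h x)))"

text \<open>The rational function represented by \<open>f\<close> on the nonempty open set \<open>W\<close> has order \<open>m\<close> at \<open>p\<close>;
  \<open>p\<close> need not lie in \<open>W\<close>.\<close>

definition has_order_at ::
    "('n::finite) ppoint set \<Rightarrow> 'n ppoint \<Rightarrow> 'n ppoint set \<Rightarrow> ('n ppoint \<Rightarrow> complex) \<Rightarrow> int \<Rightarrow> bool" where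
  "has_order_at X p W f m \<longleftrightarrow>
     (\<exists>N t u. zariski_open_in X N \<and> p \<in> N \<and> uniformizer_at X p t \<and>
        regular_on X N u \<and> u p \<noteq> 0 \<and>
        (\<forall>x\<in>N \<inter> W - {p}. t x \<noteq> 0 \<and> f x = t x powi m * u x))"

section \<open>Vector bundles\<close>

text \<open>
  All fibres are subspaces of one complex vector space \<open>('v, smul V)\<close>, which need not be
  finite-dimensional and carries no further structure. The algebraic structure is given by an
  atlas of pairs \<open>(U, e)\<close> where \<open>U\<close> is open and \<open>e 0, \<dots>, e (rk V - 1)\<close> is a frame over \<open>U\<close>;
  values of \<open>e\<close> at other indices, and of all functions of points outside their domain, are irrelevant.
\<close>

record ('n, 'v) vbundle =
  rk :: nat
  smul :: "complex \<Rightarrow> 'v \<Rightarrow> 'v"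
  fibre :: "'n ppoint \<Rightarrow> 'v set"
  atlas :: "('n ppoint set \<times> (nat \<Rightarrow> 'n ppoint \<Rightarrow> 'v)) set"

definition frame_over ::
    "('n::finite, 'v::ab_group_add) vbundle \<Rightarrow> 'n ppoint set \<Rightarrow> (nat \<Rightarrow> 'n ppoint \<Rightarrow> 'v) \<Rightarrow> bool" where
  "frame_over V U e \<longleftrightarrow>
     (\<forall>x\<in>U. inj_on (\<lambda>i. e i x) {..<rk V} \<and>
        \<not> module.dependent (smul V) ((\<lambda>i. e i x) ` {..<rk V}) \<and>
        module.span (smul V) ((\<lambda>i. e i x) ` {..<rk V}) = fibre V x)"

definition regular_section ::
    "('n::finite) ppoint set \<Rightarrow> ('n, 'v::ab_group_add) vbundle \<Rightarrow> 'n ppoint set \<Rightarrow> ('n ppoint \<Rightarrow> 'v) \<Rightarrow> bool" where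
  "regular_section X V W s \<longleftrightarrow>
     (\<forall>(U, e)\<in>atlas V. \<exists>c. (\<forall>i<rk V. regular_on X (W \<inter> U) (c i)) \<and>
        (\<forall>x\<in>W \<inter> U. s x = (\<Sum>i<rk V. smul V (c i x) (e i x))))"

definition local_frame ::
    "('n::finite) ppoint set \<Rightarrow> ('n, 'v::ab_group_add) vbundle \<Rightarrow> 'n ppoint set \<Rightarrow> (nat \<Rightarrow> 'n ppoint \<Rightarrow> 'v) \<Rightarrow> bool" where
  "local_frame X V U e \<longleftrightarrow> zariski_open_in X U \<and> frame_over V U e \<and>
     (\<forall>i<rk V. regular_section X V U (e i))"

text \<open>That the frames of the atlas consist of regular sections says that the transition matrices are regular.\<close>

definition vector_bundle :: "('n::finite) ppoint set \<Rightarrow> ('n, 'v::ab_group_add) vbundle \<Rightarrow> bool" where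
  "vector_bundle X V \<longleftrightarrow>
     vector_space (smul V) \<and>
     X \<subseteq> (\<Union>(U, e)\<in>atlas V. U) \<and>
     (\<forall>(U, e)\<in>atlas V. local_frame X V U e)"

definition adapted_frame ::
    "('n::finite) ppoint set \<Rightarrow> ('n, 'v::ab_group_add) vbundle \<Rightarrow> nat \<Rightarrow> ('n ppoint \<Rightarrow> 'v set)
      \<Rightarrow> 'n ppoint set \<Rightarrow> (nat \<Rightarrow> 'n ppoint \<Rightarrow> 'v) \<Rightarrow> bool" where
  "adapted_frame X V k E U e \<longleftrightarrow> local_frame X V U e \<and>
     (\<forall>x\<in>U. E x = module.span (smul V) ((\<lambda>i. e i x) ` {..<k}))"

text \<open>A subbundle is given by its fibres. Locally it is spanned by the first \<open>k\<close> members of a regular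
  frame of \<open>V\<close>, so it is locally a direct summand.\<close>

definition subbundle ::
    "('n::finite) ppoint set \<Rightarrow> ('n, 'v::ab_group_add) vbundle \<Rightarrow> nat \<Rightarrow> ('n ppoint \<Rightarrow> 'v set) \<Rightarrow> bool" where
  "subbundle X V k E \<longleftrightarrow> k \<le> rk V \<and> (\<forall>p\<in>X. \<exists>U e. p \<in> U \<and> adapted_frame X V k E U e)"

definition induced_bundle ::
    "('n::finite) ppoint set \<Rightarrow> ('n, 'v::ab_group_add) vbundle \<Rightarrow> nat \<Rightarrow> ('n ppoint \<Rightarrow> 'v set) \<Rightarrow> ('n, 'v) vbundle" where
  "induced_bundle X V k E =
     \<lparr>rk = k, smul = smul V, fibre = E, atlas = {(U, e). adapted_frame X V k E U e}\<rparr>"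

text \<open>
  A nonzero rational section of the determinant line bundle \<open>det V\<close>, regular on the nonempty open
  set \<open>W\<close>. It is given by its coefficients \<open>\<sigma> (U, e)\<close> with respect to \<open>e 0 \<and> \<dots> \<and> e (rk V - 1)\<close>,
  which transform by the determinants of the transition matrices of \<open>V\<close>.
\<close>

definition rational_det_section ::
    "('n::finite) ppoint set \<Rightarrow> ('n, 'v::ab_group_add) vbundle \<Rightarrow> 'n ppoint set
      \<Rightarrow> ('n ppoint set \<times> (nat \<Rightarrow> 'n ppoint \<Rightarrow> 'v) \<Rightarrow> 'n ppoint \<Rightarrow> complex) \<Rightarrow> bool" where
  "rational_det_section X V W \<sigma> \<longleftrightarrow>
     zariski_open_in X W \<and>
     (\<forall>(U, e)\<in>atlas V. regular_on X (W \<inter> U) (\<sigma> (U, e))) \<and>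
     (\<forall>(U, e)\<in>atlas V. \<forall>(U', e')\<in>atlas V. \<forall>x\<in>W \<inter> U \<inter> U'. \<forall>a.
        (\<forall>j<rk V. e' j x = (\<Sum>i<rk V. smul V (a i j) (e i x))) \<longrightarrow>
        \<sigma> (U, e) x = Determinant.det (Matrix.mat (rk V) (rk V) (\<lambda>(i, j). a i j)) * \<sigma> (U', e') x) \<and>
     (\<exists>(U, e)\<in>atlas V. \<exists>x\<in>W \<inter> U. \<sigma> (U, e) x \<noteq> 0)"

definition det_section_order ::
    "('n::finite) ppoint set \<Rightarrow> ('n, 'v::ab_group_add) vbundle \<Rightarrow> 'n ppoint set
      \<Rightarrow> ('n ppoint set \<times> (nat \<Rightarrow> 'n ppoint \<Rightarrow> 'v) \<Rightarrow> 'n ppoint \<Rightarrow> complex) \<Rightarrow> 'n ppoint \<Rightarrow> int" where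
  "det_section_order X V W \<sigma> p =
     (THE m. \<exists>(U, e)\<in>atlas V. p \<in> U \<and> has_order_at X p (W \<inter> U) (\<sigma> (U, e)) m)"

text \<open>The degree of \<open>V\<close> is that of \<open>det V\<close>: the degree of the divisor of any nonzero rational section.
  It is independent of the section because principal divisors have degree zero.\<close>

definition bundle_degree :: "('n::finite) ppoint set \<Rightarrow> ('n, 'v::ab_group_add) vbundle \<Rightarrow> int" where
  "bundle_degree X V =
     (THE d. \<exists>W \<sigma>. rational_det_section X V W \<sigma> \<and>
        d = (\<Sum>p | p \<in> X \<and> det_section_order X V W \<sigma> p \<noteq> 0. det_section_order X V W \<sigma> p))"

definition subbundle_degree ::
    "('n::finite) ppoint set \<Rightarrow> ('n, 'v::ab_group_add) vbundle \<Rightarrow> nat \<Rightarrow> ('n ppoint \<Rightarrow> 'v set) \<Rightarrow> int" where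
  "subbundle_degree X V k E = bundle_degree X (induced_bundle X V k E)"

definition semistable_bundle :: "('n::finite) ppoint set \<Rightarrow> ('n, 'v::ab_group_add) vbundle \<Rightarrow> bool" where
  "semistable_bundle X V \<longleftrightarrow>
     (\<forall>k E. 0 < k \<and> k < rk V \<and> subbundle X V k E \<longrightarrow>
        rat_of_int (subbundle_degree X V k E) / rat_of_nat k
          \<le> rat_of_int (bundle_degree X V) / rat_of_nat (rk V))"

definition stable_bundle :: "('n::finite) ppoint set \<Rightarrow> ('n, 'v::ab_group_add) vbundle \<Rightarrow> bool" where
  "stable_bundle X V \<longleftrightarrow>
     (\<forall>k E. 0 < k \<and> k < rk V \<and> subbundle X V k E \<longrightarrow>
        rat_of_int (subbundle_degree X V k E) / rat_of_nat k
          < rat_of_int (bundle_degree X V) / rat_of_nat (rk V))"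

section \<open>Quadratic bundles and semistability with respect to \<open>\<tau>\<close>\<close>

text \<open>A homomorphism from the second symmetric power of \<open>V\<close> to the structure sheaf, given as a
  symmetric bilinear form on each fibre varying regularly.\<close>

definition quadratic_form ::
    "('n::finite) ppoint set \<Rightarrow> ('n, 'v::ab_group_add) vbundle \<Rightarrow> ('n ppoint \<Rightarrow> 'v \<Rightarrow> 'v \<Rightarrow> complex) \<Rightarrow> bool" where
  "quadratic_form X V q \<longleftrightarrow>
     (\<forall>x\<in>X. \<forall>u\<in>fibre V x. \<forall>v\<in>fibre V x.
        q x u v = q x v u \<and>
        (\<forall>w\<in>fibre V x. q x (u + v) w = q x u w + q x v w) \<and>
        (\<forall>a. q x (smul V a u) v = a * q x u v)) \<and>
     (\<forall>(U, e)\<in>atlas V. \<forall>i<rk V. \<forall>j<rk V. regular_on X U (\<lambda>x. q x (e i x) (e j x)))"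

definition nondegenerate_at ::
    "('n::finite, 'v::ab_group_add) vbundle \<Rightarrow> ('n ppoint \<Rightarrow> 'v \<Rightarrow> 'v \<Rightarrow> complex) \<Rightarrow> 'n ppoint \<Rightarrow> bool" where
  "nondegenerate_at V q x \<longleftrightarrow>
     (\<forall>u\<in>fibre V x. (\<forall>v\<in>fibre V x. q x u v = 0) \<longrightarrow> u = 0)"

definition generically_nondegenerate ::
    "('n::finite) ppoint set \<Rightarrow> ('n, 'v::ab_group_add) vbundle \<Rightarrow> ('n ppoint \<Rightarrow> 'v \<Rightarrow> 'v \<Rightarrow> complex) \<Rightarrow> bool" where
  "generically_nondegenerate X V q \<longleftrightarrow>
     (\<exists>U. zariski_open_in X U \<and> U \<noteq> {} \<and> (\<forall>x\<in>U. nondegenerate_at V q x))"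

definition vanishes_on ::
    "('n::finite) ppoint set \<Rightarrow> ('n ppoint \<Rightarrow> 'v \<Rightarrow> 'v \<Rightarrow> complex)
      \<Rightarrow> ('n ppoint \<Rightarrow> 'v set) \<Rightarrow> ('n ppoint \<Rightarrow> 'v set) \<Rightarrow> bool" where
  "vanishes_on X q E E' \<longleftrightarrow> (\<forall>x\<in>X. \<forall>u\<in>E x. \<forall>v\<in>E' x. q x u v = 0)"

definition c_form ::
    "('n::finite) ppoint set \<Rightarrow> ('n, 'v) vbundle \<Rightarrow> ('n ppoint \<Rightarrow> 'v \<Rightarrow> 'v \<Rightarrow> complex)
      \<Rightarrow> ('n ppoint \<Rightarrow> 'v set) \<Rightarrow> nat" where
  "c_form X V q E =
     (if \<not> vanishes_on X q E E then 2 else if \<not> vanishes_on X q E (fibre V) then 1 else 0)"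

definition critical_filtration ::
    "('n::finite) ppoint set \<Rightarrow> ('n, 'v::ab_group_add) vbundle \<Rightarrow> ('n ppoint \<Rightarrow> 'v \<Rightarrow> 'v \<Rightarrow> complex)
      \<Rightarrow> ('n ppoint \<Rightarrow> 'v set) \<Rightarrow> ('n ppoint \<Rightarrow> 'v set) \<Rightarrow> bool" where
  "critical_filtration X V q E\<^sub>1 E\<^sub>2 \<longleftrightarrow>
     subbundle X V 1 E\<^sub>1 \<and> subbundle X V 2 E\<^sub>2 \<and> (\<forall>x\<in>X. E\<^sub>1 x \<subseteq> E\<^sub>2 x) \<and>
     vanishes_on X q E\<^sub>1 E\<^sub>2 \<and>
     \<not> vanishes_on X q E\<^sub>1 (fibre V) \<and> \<not> vanishes_on X q E\<^sub>2 (fibre V)"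

text \<open>Semistability of a conic bundle in the sense of Gomez and Sols.\<close>

definition GS_semistable ::
    "('n::finite) ppoint set \<Rightarrow> ('n, 'v::ab_group_add) vbundle \<Rightarrow> ('n ppoint \<Rightarrow> 'v \<Rightarrow> 'v \<Rightarrow> complex)
      \<Rightarrow> rat \<Rightarrow> bool" where
  "GS_semistable X V q \<tau> \<longleftrightarrow>
     (\<forall>k E. 0 < k \<and> k < rk V \<and> subbundle X V k E \<longrightarrow>
        (rat_of_int (subbundle_degree X V k E) - rat_of_nat (c_form X V q E) * \<tau>) / rat_of_nat k
          \<le> (rat_of_int (bundle_degree X V) - 2 * \<tau>) / 3) \<and>
     (\<forall>E\<^sub>1 E\<^sub>2. critical_filtration X V q E\<^sub>1 E\<^sub>2 \<longrightarrow>
        subbundle_degree X V 1 E\<^sub>1 + subbundle_degree X V 2 E\<^sub>2 \<le> bundle_degree X V)"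

end

theory Submission imports Defs begin

text \<open>
  Semistability gives \<open>deg E / k \<le> deg V / 3\<close>, which settles the filtration condition since
  \<open>1/3 + 2/3 = 1\<close>. The remaining condition reduces to \<open>c E / k \<ge> 2/3\<close>. At a point where the form
  is non-degenerate, a line is not in the radical and a plane in a 3-space is not totally isotropic,
  so \<open>c E \<ge> 1\<close> for rank 1 and \<open>c E = 2\<close> for rank 2.
\<close>

text \<open>Linearity is assumed only in the first argument and only on the span, matching
  \<open>quadratic_form\<close>, which constrains \<open>q\<close> on fibres alone. So the induction
  over the span runs on \<open>B v u\<close>, and symmetry turns the result around.\<close>

lemma (in vector_space) orthogonal_span:
  fixes B :: "'b \<Rightarrow> 'b \<Rightarrow> 'a"
  assumes sym: "\<And>u v. u \<in> span S \<Longrightarrow> v \<in> span S \<Longrightarrow> B u v = B v u"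
    and add: "\<And>u v w. u \<in> span S \<Longrightarrow> v \<in> span S \<Longrightarrow> w \<in> span S \<Longrightarrow> B (u + v) w = B u w + B v w"
    and scale: "\<And>a u v. u \<in> span S \<Longrightarrow> v \<in> span S \<Longrightarrow> B (scale a u) v = a * B u v"
    and u: "u \<in> span S" and orth: "\<And>s. s \<in> S \<Longrightarrow> B u s = 0" and v: "v \<in> span S"
  shows "B u v = 0"
proof -
  have "v \<in> span S \<and> B v u = 0"
    using v
  proof (induction rule: span_induct_alt)
    case base
    \<comment> \<open>Homogeneity with scalar 0 yields \<open>B 0 u = 0\<close>.\<close>
    show ?case using scale[of u u 0] u by (simp add: span_zero)
  next
    case (step c x y)
    have x: "x \<in> span S" using step by (simp add: span_base)
    then have "B (scale c x + y) u = c * B x u + B y u"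
      using add[of "scale c x" y u] scale[of x u c] step u by (simp add: span_scale)
    then show ?case
      using step x u sym[of u x] orth[of x] by (auto intro: span_add span_scale)
  qed
  then show ?thesis using sym u v by simp
qed

text \<open>A linear form on a plane has a nonzero kernel. A kernel vector of the pairing with
  \<open>e\<^sub>2\<close> is orthogonal to the isotropic plane as well, hence to the whole span,
  against non-degeneracy.\<close>

lemma (in vector_space) nondegenerate_no_isotropic_plane:
  fixes B :: "'b \<Rightarrow> 'b \<Rightarrow> 'a"
  assumes sym: "\<And>u v. u \<in> span {e\<^sub>0, e\<^sub>1, e\<^sub>2} \<Longrightarrow> v \<in> span {e\<^sub>0, e\<^sub>1, e\<^sub>2} \<Longrightarrow> B u v = B v u"
    and add: "\<And>u v w. u \<in> span {e\<^sub>0, e\<^sub>1, e\<^sub>2} \<Longrightarrow> v \<in> span {e\<^sub>0, e\<^sub>1, e\<^sub>2} \<Longrightarrow>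
      w \<in> span {e\<^sub>0, e\<^sub>1, e\<^sub>2} \<Longrightarrow> B (u + v) w = B u w + B v w"
    and scale: "\<And>a u v. u \<in> span {e\<^sub>0, e\<^sub>1, e\<^sub>2} \<Longrightarrow> v \<in> span {e\<^sub>0, e\<^sub>1, e\<^sub>2} \<Longrightarrow>
      B (scale a u) v = a * B u v"
    and nondeg: "\<And>u. u \<in> span {e\<^sub>0, e\<^sub>1, e\<^sub>2} \<Longrightarrow>
      (\<And>v. v \<in> span {e\<^sub>0, e\<^sub>1, e\<^sub>2} \<Longrightarrow> B u v = 0) \<Longrightarrow> u = 0"
    and indep: "independent {e\<^sub>0, e\<^sub>1}" "e\<^sub>0 \<noteq> e\<^sub>1"
    and isotropic: "B e\<^sub>0 e\<^sub>0 = 0" "B e\<^sub>0 e\<^sub>1 = 0" "B e\<^sub>1 e\<^sub>1 = 0"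
  shows False
proof -
  let ?S = "{e\<^sub>0, e\<^sub>1, e\<^sub>2}"
  have e: "e\<^sub>0 \<in> span ?S" "e\<^sub>1 \<in> span ?S" "e\<^sub>2 \<in> span ?S"
    by (simp_all add: span_base)
  have nz: "e\<^sub>0 \<noteq> 0" "e\<^sub>1 \<noteq> 0"
    using indep(1) dependent_zero by blast+
  have radical: "u = 0" if "u \<in> span ?S" "B u e\<^sub>0 = 0" "B u e\<^sub>1 = 0" "B u e\<^sub>2 = 0" for u
  proof (rule nondeg[OF that(1)])
    fix v assume "v \<in> span ?S"
    then show "B u v = 0"
      by (intro orthogonal_span[of ?S B u v, OF sym add scale that(1)]) (use that in auto)
  qed
  \<comment> \<open>The kernel of the linear form \<open>B _ e\<^sub>2\<close> on the plane lies in the radical, and \<open>u\<close> is in it.\<close>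
  define u where "u = scale (B e\<^sub>1 e\<^sub>2) e\<^sub>0 + scale (- B e\<^sub>0 e\<^sub>2) e\<^sub>1"
  have Bu: "B u w = B e\<^sub>1 e\<^sub>2 * B e\<^sub>0 w + (- B e\<^sub>0 e\<^sub>2) * B e\<^sub>1 w" if "w \<in> span ?S" for w
    unfolding u_def
    by (simp only: add[OF span_scale[OF e(1)] span_scale[OF e(2)] that] scale[OF e(1) that] scale[OF e(2) that])
  have sym10: "B e\<^sub>1 e\<^sub>0 = 0" using sym[OF e(2) e(1)] isotropic by simp
  have "u \<in> span ?S"
    unfolding u_def by (intro span_add span_scale e)
  then have "u = 0"
    by (rule radical) (simp_all add: Bu e isotropic sym10)
  then have eq: "scale (B e\<^sub>1 e\<^sub>2) e\<^sub>0 = scale (B e\<^sub>0 e\<^sub>2) e\<^sub>1"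
    by (simp add: u_def)
  \<comment> \<open>Since \<open>e\<^sub>0\<close> and \<open>e\<^sub>1\<close> are independent, the
    relation \<open>eq\<close> must be trivial. This one coefficient suffices: once it vanishes,
    \<open>e\<^sub>0\<close> itself is in the radical.\<close>
  have "B e\<^sub>0 e\<^sub>2 = 0"
  proof (rule ccontr)
    assume "B e\<^sub>0 e\<^sub>2 \<noteq> 0"
    then have "e\<^sub>1 = scale (B e\<^sub>1 e\<^sub>2 / B e\<^sub>0 e\<^sub>2) e\<^sub>0"
      using arg_cong[OF eq, of "scale (inverse (B e\<^sub>0 e\<^sub>2))"] by (simp add: field_simps)
    then have "e\<^sub>1 \<in> span {e\<^sub>0}"
      by (metis span_base span_scale singletonI)
    then show False
      using indep by (simp add: independent_insert insert_commute[of e\<^sub>0])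
  qed
  then show False
    using radical[OF e(1)] isotropic nz by simp
qed

text \<open>Restricts an adapted frame to a single point, which leaves pure linear algebra in one
  fibre.\<close>

lemma adapted_frame_at:
  assumes "vector_bundle X V" "subbundle X V k E" "x \<in> X"
  obtains e where "inj_on e {..<rk V}" "\<not> module.dependent (smul V) (e ` {..<rk V})"
    "module.span (smul V) (e ` {..<rk V}) = fibre V x" "module.span (smul V) (e ` {..<k}) = E x"
proof -
  obtain U e where "x \<in> U" "adapted_frame X V k E U e"
    using assms unfolding subbundle_def by blast
  then show ?thesis
    using that[of "\<lambda>i. e i x"]
    unfolding adapted_frame_def local_frame_def frame_over_def by auto
qed

text \<open>At a point of non-degeneracy, the first vector of an adapted frame is a nonzero element
  of \<open>E x\<close>, so it cannot be orthogonal to the whole fibre.\<close>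

lemma subbundle_not_in_radical:
  assumes V: "vector_bundle X V" and nd: "generically_nondegenerate X V q"
    and E: "subbundle X V k E" "0 < k"
  shows "\<not> vanishes_on X q E (fibre V)"
proof
  assume van: "vanishes_on X q E (fibre V)"
  \<comment> \<open>Any point of the nonempty open set will do; it lies in \<open>X\<close> because
    open sets have the form \<open>X - Z\<close>.\<close>
  obtain x where x: "x \<in> X" "nondegenerate_at V q x"
    using nd unfolding generically_nondegenerate_def zariski_open_in_def by blast
  obtain e where e: "\<not> module.dependent (smul V) (e ` {..<rk V})"
    "module.span (smul V) (e ` {..<rk V}) = fibre V x" "module.span (smul V) (e ` {..<k}) = E x"
    using adapted_frame_at[OF V E(1) x(1)] by metis
  interpret vector_space "smul V" using V unfolding vector_bundle_def by blast
  have "0 < rk V" using E unfolding subbundle_def by simp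
  then have "e 0 \<noteq> 0" "e 0 \<in> fibre V x" "e 0 \<in> E x"
    using e E(2) dependent_zero[of "e ` {..<rk V}"]
    by (force intro: span_base)+
  then show False
    using van x unfolding vanishes_on_def nondegenerate_at_def by blast
qed

text \<open>An adapted frame at a point of non-degeneracy exhibits \<open>E x\<close> as the plane
  of its first two vectors inside a 3-dimensional fibre, where the linear algebra above
  applies.\<close>

lemma rank_2_subbundle_not_isotropic:
  assumes V: "vector_bundle X V" "rk V = 3" and q: "quadratic_form X V q"
    and nd: "generically_nondegenerate X V q" and E: "subbundle X V 2 E"
  shows "\<not> vanishes_on X q E E"
proof
  assume van: "vanishes_on X q E E"
  obtain x where x: "x \<in> X" "nondegenerate_at V q x"
    using nd unfolding generically_nondegenerate_def zariski_open_in_def by blast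
  obtain e where e: "inj_on e {..<rk V}" "\<not> module.dependent (smul V) (e ` {..<rk V})"
    "module.span (smul V) (e ` {..<rk V}) = fibre V x" "module.span (smul V) (e ` {..<2}) = E x"
    using adapted_frame_at[OF V(1) E x(1)] by metis
  interpret vector_space "smul V" using V(1) unfolding vector_bundle_def by blast
  have I: "{..<3} = {0, 1, 2::nat}" "{..<2} = {0, 1::nat}" by auto
  have fib: "fibre V x = span {e 0, e 1, e 2}"
    using e(3) V(2) I by simp
  have mem: "e 0 \<in> E x" "e 1 \<in> E x"
    using e(4) I by (auto intro: span_base)
  have form: "q x u v = q x v u" "q x (smul V a u) v = a * q x u v"
      "w \<in> span {e 0, e 1, e 2} \<Longrightarrow> q x (u + v) w = q x u w + q x v w"
    if "u \<in> span {e 0, e 1, e 2}" "v \<in> span {e 0, e 1, e 2}" for a u v w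
    using q x(1) that unfolding quadratic_form_def fib[symmetric] by blast+
  have isotropic: "q x u v = 0" if "u \<in> E x" "v \<in> E x" for u v
    using van x(1) that unfolding vanishes_on_def by blast
  have "independent {e 0, e 1, e 2}"
    using e(2) V(2) I by simp
  then have indep: "independent {e 0, e 1}"
    by (rule independent_mono) blast
  have ne: "e 0 \<noteq> e 1"
    using inj_on_contraD[OF e(1), of 0 1] V(2) by simp
  have nondeg: "u = 0" if "u \<in> span {e 0, e 1, e 2}" "\<And>v. v \<in> span {e 0, e 1, e 2} \<Longrightarrow> q x u v = 0" for u
    using x(2) that unfolding nondegenerate_at_def fib by blast
  show False
    by (rule nondegenerate_no_isotropic_plane[of "e 0" "e 1" "e 2" "q x",
          OF form(1) form(3) form(2) nondeg indep ne
            isotropic[OF mem(1,1)] isotropic[OF mem] isotropic[OF mem(2,2)]])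
qed

theorem proposition10p4:
  fixes X :: "('n::finite) ppoint set"
    and V :: "('n, 'v::ab_group_add) vbundle"
    and q :: "'n ppoint \<Rightarrow> 'v \<Rightarrow> 'v \<Rightarrow> complex"
  assumes "smooth_projective_curve X"
    and "vector_bundle X V"
    and "rk V = 3"
    and "quadratic_form X V q"
    and "generically_nondegenerate X V q"
    and "semistable_bundle X V \<or> stable_bundle X V"
  shows "\<forall>\<tau>::rat. \<tau> > 0 \<longrightarrow> GS_semistable X V q \<tau>"
proof (intro allI impI)
  fix \<tau> :: rat assume \<tau>: "\<tau> > 0"
  \<comment> \<open>Strict slope inequalities imply the weak ones, so both cases of the hypothesis
    merge.\<close>
  have "semistable_bundle X V"
    using assms(6) unfolding semistable_bundle_def stable_bundle_def by (blast intro: less_imp_le)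
  then have slope: "rat_of_int (subbundle_degree X V k E) / rat_of_nat k \<le> rat_of_int (bundle_degree X V) / 3"
    if "0 < k" "k < 3" "subbundle X V k E" for k E
    using that assms(3) unfolding semistable_bundle_def by auto
  show "GS_semistable X V q \<tau>"
    unfolding GS_semistable_def
  proof (intro conjI allI impI)
    fix k E assume "0 < k \<and> k < rk V \<and> subbundle X V k E"
    then have k: "0 < k" "k < 3" and E: "subbundle X V k E" using assms(3) by auto
    \<comment> \<open>The quotient is in fact at least 1: it is 1 or 2 for a line subbundle, and 2/2
      in rank 2.\<close>
    have c: "2 / 3 \<le> rat_of_nat (c_form X V q E) / rat_of_nat k"
    proof (cases "k = 1")
      case True
      then show ?thesis
        using subbundle_not_in_radical[OF assms(2,5) E k(1)] by (simp add: c_form_def)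
    next
      case False
      then have "k = 2" using k by simp
      then show ?thesis
        using rank_2_subbundle_not_isotropic[OF assms(2-5)] E by (simp add: c_form_def)
    qed
    show "(rat_of_int (subbundle_degree X V k E) - rat_of_nat (c_form X V q E) * \<tau>) / rat_of_nat k
          \<le> (rat_of_int (bundle_degree X V) - 2 * \<tau>) / 3"
    proof -
      have "(rat_of_int (subbundle_degree X V k E) - rat_of_nat (c_form X V q E) * \<tau>) / rat_of_nat k
          = rat_of_int (subbundle_degree X V k E) / rat_of_nat k
            - rat_of_nat (c_form X V q E) / rat_of_nat k * \<tau>"
        by (simp add: diff_divide_distrib)
      also have "\<dots> \<le> rat_of_int (bundle_degree X V) / 3 - 2 / 3 * \<tau>"
        \<comment> \<open>Positivity of \<tau> preserves the lower bound \<open>c\<close> under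
          multiplication; subtracting then gives an upper bound.\<close>
        using \<tau> by (intro diff_mono slope[OF k E] mult_right_mono c) auto
      finally show ?thesis by (simp add: diff_divide_distrib)
    qed
  next
    fix E\<^sub>1 E\<^sub>2 assume "critical_filtration X V q E\<^sub>1 E\<^sub>2"
    then have "subbundle X V 1 E\<^sub>1" "subbundle X V 2 E\<^sub>2"
      unfolding critical_filtration_def by auto
    then have "rat_of_int (subbundle_degree X V 1 E\<^sub>1 + subbundle_degree X V 2 E\<^sub>2)
        \<le> rat_of_int (bundle_degree X V)"
      using slope[of 1 E\<^sub>1] slope[of 2 E\<^sub>2] by simp
    then show "subbundle_degree X V 1 E\<^sub>1 + subbundle_degree X V 2 E\<^sub>2 \<le> bundle_degree X V"
      by (simp only: of_int_le_iff)
  qed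
qed

end
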